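(* Let $\mathbf T$ be a nominal transition system with a nominal set $\mathcal F$ of effects and an equivariant function $L\colon\mathrm{ACT}_{\mathbf T}\times\mathcal P_{\mathrm{fs}}(\mathcal F)\times\mathcal F\to\mathcal P_{\mathrm{fs}}(\mathcal F)$, and let $L(\mathbf T)$ be its $L$-transform. For all $F\in\mathcal P_{\mathrm{fs}}(\mathcal F)$ and states $P,Q$ of $\mathbf T$: if $P\stackrel{F/L}{\sim}Q$ in $\mathbf T$, then $\mathrm{EF}(F,P)\stackrel{\cdot}{\sim}\mathrm{EF}(F,Q)$ in $L(\mathbf T)$.
   Context: Nominal sets over a countably infinite (possibly sorted) set of names $\mathcal N$: permutations fix all but finitely many names; every element has finite support $\operatorname{supp}$; $a\# X$ means $a\notin\operatorname{supp}(X)$; $N\# X,Y$ means every $a\in N$ is fresh for $X$ and $Y$; $[\mathcal P_{\mathrm{fin}}(\mathcal N)]S$ is $\mathcal P_{\mathrm{fin}}(\mathcal N)\times S$ modulo $(N,X)=_\alpha(N',X')$ iff some $\pi$ with $\pi\cdot(N,X)=(N',X')$ fixes every name of $\operatorname{supp}(X)\setminus N$; classes $\langle N\rangle X$. A nominal transition system: nominal sets STATES, PRED, ACT; equivariant $\vdash\subseteq\mathrm{STATES}\times\mathrm{PRED}$; equivariant $\operatorname{bn}$, $\operatorname{bn}(\alpha)$ a finite subset of $\operatorname{supp}(\alpha)$; equivariant $\rightarrow\ \subseteq\mathrm{STATES}\times[\mathcal P_{\mathrm{fin}}(\mathcal N)](\mathrm{ACT}\times\mathrm{STATES})$ with $(P,\langle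 N\rangle(\alpha,Q))\in\rightarrow$ only if $N=\operatorname{bn}(\alpha)$; $P\xrightarrow{\alpha}P'$ means $(P,\langle\operatorname{bn}(\alpha)\rangle(\alpha,P'))\in\rightarrow$. A bisimulation is a symmetric relation $R$ on states with: $R(P,Q)$ implies (1) $P\vdash\varphi\Rightarrow Q\vdash\varphi$ for all $\varphi$; (2) whenever $\operatorname{bn}(\alpha)\# Q$ and $P\xrightarrow{\alpha}P'$ there is $Q'$ with $Q\xrightarrow{\alpha}Q'$ and $R(P',Q')$. $\stackrel{\cdot}{\sim}$ is the union of all bisimulations. An effect is a finitely supported function from states to states; $\mathcal F$ is a nominal set of effects; $\mathcal P_{\mathrm{fs}}(\mathcal F)$ its finitely supported subsets. An $L$-bisimulation is a family $\{R_F\}_{F\in\mathcal P_{\mathrm{fs}}(\mathcal F)}$ of symmetric relations on states with: $R_F(P,Q)$ implies (1) for all $f\in F$, $\varphi$: $f(P)\vdash\varphi\Rightarrow f(Q)\vdash\varphi$; (2) for all $f\in F$, $\alpha,P'$ with $\operatorname{bn}(\alpha)\# f(Q),F,f$: if $f(P)\xrightarrow{\alpha}P'$ then some $Q'$ has $f(Q)\xrightarrow{\alpha}Q'$ and $R_{L(\alpha,F,f)}(P',Q')$. $P\stackrel{F/L}{\sim}Q$ iff some $L$-bisimulation has $R_F(P,Q)$. The $L$-transform $L(\mathbf T)$ is the nominal transition system with: states $\mathrm{AC}(f,F,P)$ ($f\in\mathcal F$, $F\in\mathcal P_{\mathrm{fs}}(\mathcal F)$, $P\in\mathrm{STATES}_{\mathbf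 T}$) and $\mathrm{EF}(F,P)$ ($F\in\mathcal P_{\mathrm{fs}}(\mathcal F)$, $P\in\mathrm{STATES}_{\mathbf T}$), permutations acting componentwise; predicates $\mathrm{PRED}_{\mathbf T}$ with $\mathrm{AC}(f,F,P)\vdash\varphi$ iff $P\vdash_{\mathbf T}\varphi$ and $\mathrm{EF}(F,P)\vdash\varphi$ never; actions $\mathrm{ACT}_{\mathbf T}\uplus\mathcal F$, with $\operatorname{bn}$ as in $\mathbf T$ on $\mathrm{ACT}_{\mathbf T}$ and $\operatorname{bn}(f)=\emptyset$ for $f\in\mathcal F$; transitions: $\mathrm{AC}(f,F,P)\xrightarrow{\alpha}\mathrm{EF}(L(\alpha,F,f),P')$ whenever $P\xrightarrow{\alpha}P'$ in $\mathbf T$ with $\operatorname{bn}(\alpha)\# f,F$, and $\mathrm{EF}(F,P)\xrightarrow{f}\mathrm{AC}(f,F,f(P))$ for each $f\in F$. *)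

theory Defs
  imports "HOL-Combinatorics.Perm" "HOL-Library.FuncSet" "HOL-Library.Countable"
begin

section \<open>Names and permutations\<close>

text \<open>
  Sorts are numbered by natural numbers, which loses nothing because there are only countably many
  names. The unsorted case is a constant \<open>sort_of\<close>. Every inhabited sort is infinite, as is
  standard for many-sorted nominal sets (otherwise least supports need not exist).
\<close>

class names = countable +
  fixes sort_of :: "'a \<Rightarrow> nat"
  assumes infinite_sort: "infinite {b. sort_of b = sort_of a}"

definition sorted_perms :: "'n::names perm set" where
  "sorted_perms = {\<pi>. \<forall>a. sort_of (apply \<pi> a) = sort_of a}"

section \<open>Nominal sets\<close>

text \<open>
  A nominal set is a carrier \<open>X\<close> together with an action \<open>act\<close>; only the values of \<open>act\<close> on
  sort-preserving permutations and on elements of the carrier matter.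
\<close>

definition supports :: "('n::names perm \<Rightarrow> 'x \<Rightarrow> 'x) \<Rightarrow> 'n set \<Rightarrow> 'x \<Rightarrow> bool" where
  "supports act A x \<longleftrightarrow> (\<forall>\<pi>\<in>sorted_perms. (\<forall>a\<in>A. apply \<pi> a = a) \<longrightarrow> act \<pi> x = x)"

definition finitely_supported :: "('n::names perm \<Rightarrow> 'x \<Rightarrow> 'x) \<Rightarrow> 'x \<Rightarrow> bool" where
  "finitely_supported act x \<longleftrightarrow> (\<exists>A. finite A \<and> supports act A x)"

definition supp :: "('n::names perm \<Rightarrow> 'x \<Rightarrow> 'x) \<Rightarrow> 'x \<Rightarrow> 'n set" where
  "supp act x = \<Inter>{A. finite A \<and> supports act A x}"

definition fresh :: "('n::names perm \<Rightarrow> 'x \<Rightarrow> 'x) \<Rightarrow> 'n set \<Rightarrow> 'x \<Rightarrow> bool" where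
  "fresh act N x \<longleftrightarrow> (\<forall>a\<in>N. a \<notin> supp act x)"

locale nominal_set =
  fixes X :: "'x set" and act :: "'n::names perm \<Rightarrow> 'x \<Rightarrow> 'x"
  assumes act_closed: "\<lbrakk>\<pi> \<in> sorted_perms; x \<in> X\<rbrakk> \<Longrightarrow> act \<pi> x \<in> X"
    and act_one: "x \<in> X \<Longrightarrow> act 1 x = x"
    and act_times: "\<lbrakk>\<pi> \<in> sorted_perms; \<sigma> \<in> sorted_perms; x \<in> X\<rbrakk>
      \<Longrightarrow> act (\<pi> * \<sigma>) x = act \<pi> (act \<sigma> x)"
    and finite_support: "x \<in> X \<Longrightarrow> finitely_supported act x"

definition perm_set :: "('n perm \<Rightarrow> 'x \<Rightarrow> 'x) \<Rightarrow> 'n perm \<Rightarrow> 'x set \<Rightarrow> 'x set" where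
  "perm_set act \<pi> A = act \<pi> ` A"

definition perm_prod ::
    "('n perm \<Rightarrow> 'x \<Rightarrow> 'x) \<Rightarrow> ('n perm \<Rightarrow> 'y \<Rightarrow> 'y) \<Rightarrow> 'n perm \<Rightarrow> 'x \<times> 'y \<Rightarrow> 'x \<times> 'y" where
  "perm_prod actx acty \<pi> = map_prod (actx \<pi>) (acty \<pi>)"

definition equivariant_set :: "('n::names perm \<Rightarrow> 'x \<Rightarrow> 'x) \<Rightarrow> 'x set \<Rightarrow> bool" where
  "equivariant_set act R \<longleftrightarrow> (\<forall>\<pi>\<in>sorted_perms. \<forall>x\<in>R. act \<pi> x \<in> R)"

definition equivariant_fun ::
    "'x set \<Rightarrow> ('n::names perm \<Rightarrow> 'x \<Rightarrow> 'x) \<Rightarrow> ('n perm \<Rightarrow> 'y \<Rightarrow> 'y) \<Rightarrow> ('x \<Rightarrow> 'y) \<Rightarrow> bool" where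
  "equivariant_fun X actx acty g \<longleftrightarrow>
    (\<forall>\<pi>\<in>sorted_perms. \<forall>x\<in>X. g (actx \<pi> x) = acty \<pi> (g x))"

definition Pfs :: "('n::names perm \<Rightarrow> 'x \<Rightarrow> 'x) \<Rightarrow> 'x set \<Rightarrow> 'x set set" where
  "Pfs act X = {A. A \<subseteq> X \<and> finitely_supported (perm_set act) A}"

section \<open>Abstractions of finite sets of names\<close>

definition alpha_rel ::
    "'x set \<Rightarrow> ('n::names perm \<Rightarrow> 'x \<Rightarrow> 'x) \<Rightarrow> (('n set \<times> 'x) \<times> ('n set \<times> 'x)) set" where
  "alpha_rel X act =
    {((N, x), (N', x')). finite N \<and> x \<in> X \<and> finite N' \<and> x' \<in> X \<and>
      (\<exists>\<pi>\<in>sorted_perms. perm_prod (perm_set apply) act \<pi> (N, x) = (N', x') \<and>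
        (\<forall>a\<in>supp act x - N. apply \<pi> a = a))}"

definition abstractions ::
    "'x set \<Rightarrow> ('n::names perm \<Rightarrow> 'x \<Rightarrow> 'x) \<Rightarrow> ('n set \<times> 'x) set set" where
  "abstractions X act = ({N. finite N} \<times> X) // alpha_rel X act"

definition abstr ::
    "'x set \<Rightarrow> ('n::names perm \<Rightarrow> 'x \<Rightarrow> 'x) \<Rightarrow> 'n set \<Rightarrow> 'x \<Rightarrow> ('n set \<times> 'x) set" where
  "abstr X act N x = alpha_rel X act `` {(N, x)}"

definition perm_abstr ::
    "('n::names perm \<Rightarrow> 'x \<Rightarrow> 'x) \<Rightarrow> 'n perm \<Rightarrow> ('n set \<times> 'x) set \<Rightarrow> ('n set \<times> 'x) set" where
  "perm_abstr act = perm_set (perm_prod (perm_set apply) act)"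

section \<open>Nominal transition systems and bisimilarity\<close>

record ('n, 's, 'p, 'a) nts =
  States :: "'s set"
  Preds :: "'p set"
  Acts :: "'a set"
  perm_state :: "'n perm \<Rightarrow> 's \<Rightarrow> 's"
  perm_pred :: "'n perm \<Rightarrow> 'p \<Rightarrow> 'p"
  perm_act :: "'n perm \<Rightarrow> 'a \<Rightarrow> 'a"
  sat :: "('s \<times> 'p) set"
  bn :: "'a \<Rightarrow> 'n set"
  transitions :: "('s \<times> ('n set \<times> ('a \<times> 's)) set) set"

definition residual ::
    "('n::names, 's, 'p, 'a) nts \<Rightarrow> 'n set \<Rightarrow> 'a \<Rightarrow> 's \<Rightarrow> ('n set \<times> ('a \<times> 's)) set" where
  "residual T N \<alpha> Q = abstr (Acts T \<times> States T) (perm_prod (perm_act T) (perm_state T)) N (\<alpha>, Q)"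

locale nominal_transition_system =
  fixes T :: "('n::names, 's, 'p, 'a) nts"
  assumes states_nominal: "nominal_set (States T) (perm_state T)"
    and preds_nominal: "nominal_set (Preds T) (perm_pred T)"
    and acts_nominal: "nominal_set (Acts T) (perm_act T)"
    and sat_subset: "sat T \<subseteq> States T \<times> Preds T"
    and sat_equivariant: "equivariant_set (perm_prod (perm_state T) (perm_pred T)) (sat T)"
    and bn_finite: "\<alpha> \<in> Acts T \<Longrightarrow> finite (bn T \<alpha>)"
    and bn_supp: "\<alpha> \<in> Acts T \<Longrightarrow> bn T \<alpha> \<subseteq> supp (perm_act T) \<alpha>"
    and bn_equivariant: "equivariant_fun (Acts T) (perm_act T) (perm_set apply) (bn T)"
    and transitions_subset: "transitions T \<subseteq> States T \<times>
      abstractions (Acts T \<times> States T) (perm_prod (perm_act T) (perm_state T))"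
    and transitions_equivariant: "equivariant_set
      (perm_prod (perm_state T) (perm_abstr (perm_prod (perm_act T) (perm_state T))))
      (transitions T)"
    and transitions_bn: "\<lbrakk>finite N; \<alpha> \<in> Acts T; Q \<in> States T; (P, residual T N \<alpha> Q) \<in> transitions T\<rbrakk>
      \<Longrightarrow> N = bn T \<alpha>"

definition step :: "('n::names, 's, 'p, 'a) nts \<Rightarrow> 's \<Rightarrow> 'a \<Rightarrow> 's \<Rightarrow> bool" where
  "step T P \<alpha> P' \<longleftrightarrow> (P, residual T (bn T \<alpha>) \<alpha> P') \<in> transitions T"

definition bisimulation :: "('n::names, 's, 'p, 'a) nts \<Rightarrow> ('s \<times> 's) set \<Rightarrow> bool" where
  "bisimulation T R \<longleftrightarrow> R \<subseteq> States T \<times> States T \<and> sym R \<and>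
    (\<forall>(P, Q)\<in>R.
      (\<forall>\<phi>\<in>Preds T. (P, \<phi>) \<in> sat T \<longrightarrow> (Q, \<phi>) \<in> sat T) \<and>
      (\<forall>\<alpha>\<in>Acts T. \<forall>P'\<in>States T. fresh (perm_state T) (bn T \<alpha>) Q \<and> step T P \<alpha> P' \<longrightarrow>
        (\<exists>Q'\<in>States T. step T Q \<alpha> Q' \<and> (P', Q') \<in> R)))"

definition bisimilarity :: "('n::names, 's, 'p, 'a) nts \<Rightarrow> ('s \<times> 's) set" where
  "bisimilarity T = \<Union>{R. bisimulation T R}"

section \<open>Effects and \<open>L\<close>-bisimilarity\<close>

text \<open>
  Functions on states are extensional, i.e. take the value \<open>undefined\<close> outside the carrier, so that
  equality of such functions is equality on the carrier. Permutations act on them by conjugation.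
\<close>

definition perm_eff ::
    "('n::names, 's, 'p, 'a) nts \<Rightarrow> 'n perm \<Rightarrow> ('s \<Rightarrow> 's) \<Rightarrow> ('s \<Rightarrow> 's)" where
  "perm_eff T \<pi> f = (\<lambda>P\<in>States T. perm_state T \<pi> (f (perm_state T (inverse \<pi>) P)))"

definition effects :: "('n::names, 's, 'p, 'a) nts \<Rightarrow> ('s \<Rightarrow> 's) set" where
  "effects T = {f \<in> States T \<rightarrow>\<^sub>E States T. finitely_supported (perm_eff T) f}"

definition nominal_effect_set :: "('n::names, 's, 'p, 'a) nts \<Rightarrow> ('s \<Rightarrow> 's) set \<Rightarrow> bool" where
  "nominal_effect_set T \<F> \<longleftrightarrow> \<F> \<subseteq> effects T \<and> nominal_set \<F> (perm_eff T)"

definition L_bisimulation ::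
    "('n::names, 's, 'p, 'a) nts \<Rightarrow> ('s \<Rightarrow> 's) set \<Rightarrow>
      ('a \<times> ('s \<Rightarrow> 's) set \<times> ('s \<Rightarrow> 's) \<Rightarrow> ('s \<Rightarrow> 's) set) \<Rightarrow>
      (('s \<Rightarrow> 's) set \<Rightarrow> ('s \<times> 's) set) \<Rightarrow> bool" where
  "L_bisimulation T \<F> L R \<longleftrightarrow>
    (\<forall>F\<in>Pfs (perm_eff T) \<F>. R F \<subseteq> States T \<times> States T \<and> sym (R F) \<and>
      (\<forall>(P, Q)\<in>R F.
        (\<forall>f\<in>F. \<forall>\<phi>\<in>Preds T. (f P, \<phi>) \<in> sat T \<longrightarrow> (f Q, \<phi>) \<in> sat T) \<and>
        (\<forall>f\<in>F. \<forall>\<alpha>\<in>Acts T. \<forall>P'\<in>States T.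
          fresh (perm_state T) (bn T \<alpha>) (f Q) \<and>
          fresh (perm_set (perm_eff T)) (bn T \<alpha>) F \<and>
          fresh (perm_eff T) (bn T \<alpha>) f \<longrightarrow>
          step T (f P) \<alpha> P' \<longrightarrow>
          (\<exists>Q'\<in>States T. step T (f Q) \<alpha> Q' \<and> (P', Q') \<in> R (L (\<alpha>, F, f))))))"

definition L_bisimilar ::
    "('n::names, 's, 'p, 'a) nts \<Rightarrow> ('s \<Rightarrow> 's) set \<Rightarrow>
      ('a \<times> ('s \<Rightarrow> 's) set \<times> ('s \<Rightarrow> 's) \<Rightarrow> ('s \<Rightarrow> 's) set) \<Rightarrow>
      ('s \<Rightarrow> 's) set \<Rightarrow> 's \<Rightarrow> 's \<Rightarrow> bool" where
  "L_bisimilar T \<F> L F P Q \<longleftrightarrow> (\<exists>R. L_bisimulation T \<F> L R \<and> (P, Q) \<in> R F)"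

section \<open>The \<open>L\<close>-transform\<close>

datatype 's lstate =
    AC "'s \<Rightarrow> 's" "('s \<Rightarrow> 's) set" 's
  | EF "('s \<Rightarrow> 's) set" 's

fun perm_lstate ::
    "('n::names, 's, 'p, 'a) nts \<Rightarrow> 'n perm \<Rightarrow> 's lstate \<Rightarrow> 's lstate" where
  "perm_lstate T \<pi> (AC f F P) =
    AC (perm_eff T \<pi> f) (perm_set (perm_eff T) \<pi> F) (perm_state T \<pi> P)"
| "perm_lstate T \<pi> (EF F P) = EF (perm_set (perm_eff T) \<pi> F) (perm_state T \<pi> P)"

definition perm_lact ::
    "('n::names, 's, 'p, 'a) nts \<Rightarrow> 'n perm \<Rightarrow> 'a + ('s \<Rightarrow> 's) \<Rightarrow> 'a + ('s \<Rightarrow> 's)" where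
  "perm_lact T \<pi> = map_sum (perm_act T \<pi>) (perm_eff T \<pi>)"

definition lstates ::
    "('n::names, 's, 'p, 'a) nts \<Rightarrow> ('s \<Rightarrow> 's) set \<Rightarrow> 's lstate set" where
  "lstates T \<F> =
    {AC f F P | f F P. f \<in> \<F> \<and> F \<in> Pfs (perm_eff T) \<F> \<and> P \<in> States T} \<union>
    {EF F P | F P. F \<in> Pfs (perm_eff T) \<F> \<and> P \<in> States T}"

definition lresidual ::
    "('n::names, 's, 'p, 'a) nts \<Rightarrow> ('s \<Rightarrow> 's) set \<Rightarrow> 'n set \<Rightarrow> 'a + ('s \<Rightarrow> 's) \<Rightarrow> 's lstate \<Rightarrow>
      ('n set \<times> (('a + ('s \<Rightarrow> 's)) \<times> 's lstate)) set" where
  "lresidual T \<F> N x S =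
    abstr ((Acts T <+> \<F>) \<times> lstates T \<F>) (perm_prod (perm_lact T) (perm_lstate T)) N (x, S)"

definition L_transform ::
    "('n::names, 's, 'p, 'a) nts \<Rightarrow> ('s \<Rightarrow> 's) set \<Rightarrow>
      ('a \<times> ('s \<Rightarrow> 's) set \<times> ('s \<Rightarrow> 's) \<Rightarrow> ('s \<Rightarrow> 's) set) \<Rightarrow>
      ('n, 's lstate, 'p, 'a + ('s \<Rightarrow> 's)) nts" where
  "L_transform T \<F> L =
    \<lparr> States = lstates T \<F>,
      Preds = Preds T,
      Acts = Acts T <+> \<F>,
      perm_state = perm_lstate T,
      perm_pred = perm_pred T,
      perm_act = perm_lact T,
      sat = {(AC f F P, \<phi>) | f F P \<phi>. AC f F P \<in> lstates T \<F> \<and> (P, \<phi>) \<in> sat T},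
      bn = case_sum (bn T) (\<lambda>_. {}),
      transitions =
        {(AC f F P, lresidual T \<F> (bn T \<alpha>) (Inl \<alpha>) (EF (L (\<alpha>, F, f)) P')) | f F P \<alpha> P'.
          f \<in> \<F> \<and> F \<in> Pfs (perm_eff T) \<F> \<and> P \<in> States T \<and> \<alpha> \<in> Acts T \<and> P' \<in> States T \<and>
          step T P \<alpha> P' \<and>
          fresh (perm_eff T) (bn T \<alpha>) f \<and> fresh (perm_set (perm_eff T)) (bn T \<alpha>) F} \<union>
        {(EF F P, lresidual T \<F> {} (Inr f) (AC f F (f P))) | F P f.
          F \<in> Pfs (perm_eff T) \<F> \<and> P \<in> States T \<and> f \<in> F} \<rparr>"

end

theory Submission
  imports Defs
begin

text \<open>
  Given an \<open>L\<close>-bisimulation \<open>R\<close>, the pairs \<open>(EF F P, EF F Q)\<close> and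
  \<open>(AC f F (f P), AC f F (f Q))\<close> with \<open>(P, Q) \<in> R F\<close> and \<open>f \<in> F\<close> form a bisimulation of the
  \<open>L\<close>-transform. The only difficulty is alpha-conversion: a transition of \<open>AC f F (f P)\<close> with label
  \<open>\<alpha>\<close> is presented by a representative \<open>(\<beta>, EF (L (\<beta>, F, f)) P')\<close>, and the renaming taking \<open>\<beta>\<close>
  to \<open>\<alpha>\<close> need not fix \<open>f\<close> and \<open>F\<close>, which may have names that do not occur in \<open>L (\<beta>, F, f)\<close>.
  Since the binding names of both \<open>\<alpha>\<close> and \<open>\<beta>\<close> are fresh for \<open>f\<close> and \<open>F\<close>, the renaming can be
  replaced by one that does fix them, and then equivariance of \<open>L\<close> applies.
\<close>

section \<open>Permutations\<close>

unbundle permutation_syntax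

lemma sorted_perms_one: "1 \<in> sorted_perms"
  by (simp add: sorted_perms_def)

lemma sorted_perms_times: "\<pi> \<in> sorted_perms \<Longrightarrow> \<sigma> \<in> sorted_perms \<Longrightarrow> \<pi> * \<sigma> \<in> sorted_perms"
  by (simp add: sorted_perms_def apply_times)

lemma apply_inverse_cancel:
  "inverse \<pi> \<langle>$\<rangle> (\<pi> \<langle>$\<rangle> a) = a" "\<pi> \<langle>$\<rangle> (inverse \<pi> \<langle>$\<rangle> a) = a"
  by (simp_all add: apply_sequence)

lemma sorted_perms_inverse:
  assumes "\<pi> \<in> sorted_perms" shows "inverse \<pi> \<in> sorted_perms"
  unfolding sorted_perms_def
proof safe
  fix a
  have "sort_of (\<pi> \<langle>$\<rangle> (inverse \<pi> \<langle>$\<rangle> a)) = sort_of (inverse \<pi> \<langle>$\<rangle> a)"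
    using assms unfolding sorted_perms_def by blast
  then show "sort_of (inverse \<pi> \<langle>$\<rangle> a) = sort_of a"
    by (simp add: apply_inverse_cancel)
qed

lemma sorted_perms_swap: "sort_of a = sort_of b \<Longrightarrow> \<langle>a \<leftrightarrow> b\<rangle> \<in> sorted_perms"
  unfolding sorted_perms_def
  by (simp, metis apply_swap_simp apply_swap_same)

text \<open>A finite injective renaming can be realised by swaps: once \<open>\<rho>\<close> is
  right on \<open>C\<close> and \<open>D\<close>, one more swap corrects it at a new name
  \<open>d\<close>. No swap touches \<open>C\<close>, so \<open>C\<close> may be infinite. The
  parameter \<open>I\<close> is any property that such swaps preserve; it is instantiated with
  fixing an element and, elsewhere, with \<open>True\<close>.\<close>

lemma extend_to_sorted_perm:
  assumes "finite D" and "inj_on g (C \<union> D)"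
    and "\<And>a. a \<in> C \<Longrightarrow> g a = a" and "\<And>a. a \<in> D \<Longrightarrow> sort_of (g a) = sort_of a"
    and one: "I 1"
    and swap: "\<And>a b \<rho>. \<lbrakk>\<rho> \<in> sorted_perms; I \<rho>; sort_of a = sort_of b; a \<notin> C; b \<notin> C\<rbrakk>
      \<Longrightarrow> I (\<langle>a \<leftrightarrow> b\<rangle> * \<rho>)"
  obtains \<rho> where "\<rho> \<in> sorted_perms" "I \<rho>" "\<And>a. a \<in> C \<union> D \<Longrightarrow> \<rho> \<langle>$\<rangle> a = g a"
proof -
  have "\<exists>\<rho>\<in>sorted_perms. I \<rho> \<and> (\<forall>a\<in>C \<union> D. \<rho> \<langle>$\<rangle> a = g a)"
    using assms(1-4)
  proof (induction D)
    case empty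
    then show ?case
      by (intro bexI[of _ 1]) (auto simp: one sorted_perms_one)
  next
    case (insert d D)
    then obtain \<rho> where \<rho>: "\<rho> \<in> sorted_perms" "I \<rho>" "\<forall>a\<in>C \<union> D. \<rho> \<langle>$\<rangle> a = g a"
      by (auto simp: inj_on_Un)
    show ?case
    proof (cases "d \<in> C")
      case True
      with \<rho> show ?thesis by blast
    next
      case False
      have eq: "g a = g d \<longleftrightarrow> a = d" if "a \<in> C \<union> D" for a
        using that by (intro inj_on_eq_iff[OF insert.prems(1)]) auto
      \<comment> \<open>If \<open>g d\<close> were in \<open>C\<close>, then
        \<open>g (g d) = g d\<close>, and injectivity would give \<open>g d = d\<close>, although
        \<open>d \<notin> C\<close>. The image of \<open>d\<close> under \<open>\<rho>\<close> is
        treated in the same way.\<close>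
      have gd: "g d \<notin> C"
        using eq False insert.prems(2) by force
      have \<rho>d: "\<rho> \<langle>$\<rangle> d \<notin> C"
        using \<rho>(3) False insert.prems(2) by (metis UnI1 apply_inj)
      have sort: "sort_of (g d) = sort_of (\<rho> \<langle>$\<rangle> d)"
        using \<rho>(1) insert.prems(3) by (simp add: sorted_perms_def)
      have "(\<langle>g d \<leftrightarrow> \<rho> \<langle>$\<rangle> d\<rangle> * \<rho>) \<langle>$\<rangle> a = g a" if "a \<in> C \<union> insert d D" for a
      proof (cases "a = d")
        case False
        with that have a: "a \<in> C \<union> D" by auto
        \<comment> \<open>The new swap leaves \<open>g a\<close> alone: \<open>g\<close> is
          injective, and so is \<open>\<rho>\<close>, which already sends \<open>a\<close> to
          \<open>g a\<close>.\<close>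
        then have "g a \<noteq> g d" "g a \<noteq> \<rho> \<langle>$\<rangle> d"
          using eq \<rho>(3) False by (auto simp: apply_inj dest!: bspec[of _ _ a])
        with \<rho>(3) a show ?thesis by (simp add: apply_times)
      qed (simp add: apply_times)
      then show ?thesis
        using swap[OF \<rho>(1,2) sort gd \<rho>d] sorted_perms_times[OF sorted_perms_swap[OF sort] \<rho>(1)]
        by blast
    qed
  qed
  with that show thesis by blast
qed

section \<open>Least supports\<close>

lemma supportsD:
  "\<lbrakk>supports act A x; \<pi> \<in> sorted_perms; \<And>a. a \<in> A \<Longrightarrow> \<pi> \<langle>$\<rangle> a = a\<rbrakk> \<Longrightarrow> act \<pi> x = x"
  by (simp add: supports_def)

lemma supp_subset: "finite A \<Longrightarrow> supports act A x \<Longrightarrow> supp act x \<subseteq> A"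
  by (auto simp: supp_def)

lemma supp_mono:
  assumes "\<And>A. supports act A x \<Longrightarrow> supports act' A x'"
  shows "supp act' x' \<subseteq> supp act x"
  using assms by (auto simp: supp_def)

context nominal_set
begin

text \<open>The permutation \<open>inverse \<rho> * \<pi>\<close> fixes every name of
  \<open>A\<close>, hence fixes \<open>x\<close>.\<close>

lemma act_eq_if_eq_on_support:
  assumes "x \<in> X" "supports act A x" "\<pi> \<in> sorted_perms" "\<rho> \<in> sorted_perms"
    and "\<And>a. a \<in> A \<Longrightarrow> \<pi> \<langle>$\<rangle> a = \<rho> \<langle>$\<rangle> a"
  shows "act \<pi> x = act \<rho> x"
proof -
  have *: "inverse \<rho> * \<pi> \<in> sorted_perms"
    using assms by (simp add: sorted_perms_times sorted_perms_inverse)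
  have "act (inverse \<rho> * \<pi>) x = x"
    by (rule supportsD[OF assms(2) *]) (simp add: assms(5) apply_times apply_inverse_cancel)
  moreover have "act (\<rho> * (inverse \<rho> * \<pi>)) x = act \<rho> (act (inverse \<rho> * \<pi>) x)"
    using assms * by (intro act_times)
  ultimately show ?thesis
    by (simp flip: mult.assoc)
qed

text \<open>Every swap of equally sorted names outside \<open>A \<inter> B\<close> fixes
  \<open>x\<close>, and a permutation fixing \<open>A \<inter> B\<close> pointwise agrees on
  \<open>A\<close> with a product of such swaps.\<close>

lemma supports_Int:
  assumes "x \<in> X" "finite A" "supports act A x" "finite B" "supports act B x"
  shows "supports act (A \<inter> B) x"
proof -
  \<comment> \<open>Here \<open>b\<close> lies in neither set and \<open>a\<close> misses at least
    one of them, so the swap fixes that one pointwise.\<close>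
  have outside: "act \<langle>a \<leftrightarrow> b\<rangle> x = x"
    if "sort_of a = sort_of b" "b \<notin> A \<union> B" "a \<notin> A \<inter> B" for a b
  proof (cases "a \<in> A")
    case True
    show ?thesis
      by (rule supportsD[OF assms(5) sorted_perms_swap[OF that(1)]])
        (use that True in \<open>metis IntI UnCI apply_swap_same\<close>)
  next
    case False
    show ?thesis
      by (rule supportsD[OF assms(3) sorted_perms_swap[OF that(1)]])
        (use that False in \<open>metis UnCI apply_swap_same\<close>)
  qed
  have swap: "act \<langle>a \<leftrightarrow> b\<rangle> x = x"
    if ab: "sort_of a = sort_of b" "a \<notin> A \<inter> B" "b \<notin> A \<inter> B" for a b
  proof (cases "a = b")
    case True
    then show ?thesis using assms by (simp add: act_one)
  next
    case False
    \<comment> \<open>Sorts are infinite, which gives a \<open>c\<close> outside both supports.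
      Conjugating the swap of \<open>b\<close> and \<open>c\<close> by the swap of \<open>a\<close>
      and \<open>c\<close> yields the swap of \<open>a\<close> and \<open>b\<close>, and both of
      these fix \<open>x\<close>.\<close>
    have "infinite ({c. sort_of c = sort_of a} - (A \<union> B \<union> {a, b}))"
      using assms infinite_sort[of a] by (intro Diff_infinite_finite) auto
    then have "{c. sort_of c = sort_of a} - (A \<union> B \<union> {a, b}) \<noteq> {}"
      by (rule infinite_imp_nonempty)
    then obtain c where c: "sort_of c = sort_of a" "c \<notin> A \<union> B" "c \<noteq> a" "c \<noteq> b"
      by blast
    have fix_ac: "act \<langle>a \<leftrightarrow> c\<rangle> x = x" and fix_bc: "act \<langle>b \<leftrightarrow> c\<rangle> x = x"
      using c ab by (auto intro!: outside)
    have sp: "\<langle>a \<leftrightarrow> c\<rangle> \<in> sorted_perms" "\<langle>b \<leftrightarrow> c\<rangle> \<in> sorted_perms"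
      using c ab by (auto intro!: sorted_perms_swap)
    have "\<langle>a \<leftrightarrow> b\<rangle> = \<langle>a \<leftrightarrow> c\<rangle> * (\<langle>b \<leftrightarrow> c\<rangle> * \<langle>a \<leftrightarrow> c\<rangle>)"
    proof (rule perm_eqI)
      fix d
      show "\<langle>a \<leftrightarrow> b\<rangle> \<langle>$\<rangle> d = (\<langle>a \<leftrightarrow> c\<rangle> * (\<langle>b \<leftrightarrow> c\<rangle> * \<langle>a \<leftrightarrow> c\<rangle>)) \<langle>$\<rangle> d"
        using False c by (cases "d = a"; cases "d = b"; cases "d = c") (auto simp: apply_times)
    qed
    also have "act \<dots> x = x"
      using assms(1) sp fix_ac fix_bc by (simp add: act_times sorted_perms_times)
    finally show ?thesis .
  qed
  show ?thesis
    unfolding supports_def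
  proof (intro ballI impI)
    fix \<pi> assume \<pi>: "\<pi> \<in> sorted_perms" "\<forall>a\<in>A \<inter> B. \<pi> \<langle>$\<rangle> a = a"
    \<comment> \<open>The invariant is that \<open>x\<close> is fixed. Since \<open>A\<close>
      supports \<open>x\<close>, agreement of \<open>\<rho>\<close> and \<open>\<pi>\<close> on
      \<open>A\<close> suffices.\<close>
    obtain \<rho> where \<rho>: "\<rho> \<in> sorted_perms" "act \<rho> x = x"
      "\<And>a. a \<in> A \<inter> B \<union> A \<Longrightarrow> \<rho> \<langle>$\<rangle> a = \<pi> \<langle>$\<rangle> a"
    proof (rule extend_to_sorted_perm[of A "apply \<pi>" "A \<inter> B" "\<lambda>\<rho>. act \<rho> x = x"])
      show "inj_on (apply \<pi>) (A \<inter> B \<union> A)" by (auto simp: inj_on_def apply_inj)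
      show "sort_of (\<pi> \<langle>$\<rangle> a) = sort_of a" for a using \<pi>(1) by (simp add: sorted_perms_def)
      show "act (\<langle>a \<leftrightarrow> b\<rangle> * \<rho>) x = x"
        if "\<rho> \<in> sorted_perms" "act \<rho> x = x" "sort_of a = sort_of b" "a \<notin> A \<inter> B" "b \<notin> A \<inter> B"
        for a b \<rho>
        using that assms(1) by (simp add: act_times sorted_perms_swap swap)
    qed (use assms \<pi> in \<open>auto simp: act_one\<close>)
    have "act \<pi> x = act \<rho> x"
      by (rule act_eq_if_eq_on_support[OF assms(1,3) \<pi>(1) \<rho>(1)]) (simp add: \<rho>(3))
    with \<rho> show "act \<pi> x = x" by simp
  qed
qed

text \<open>A support of least cardinality lies inside every finite support, because its
  intersection with that one is again a support and cannot be smaller. It therefore equals the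
  intersection \<open>supp\<close>.\<close>

lemma
  assumes "x \<in> X"
  shows finite_supp: "finite (supp act x)" and supports_supp: "supports act (supp act x) x"
proof -
  let ?P = "\<lambda>A. finite A \<and> supports act A x"
  obtain A where A: "?P A" "\<And>B. ?P B \<Longrightarrow> card A \<le> card B"
    using finite_support[OF assms] ex_has_least_nat[of ?P _ card]
    unfolding finitely_supported_def by blast
  have "A \<subseteq> B" if "?P B" for B
  proof -
    have "card A \<le> card (A \<inter> B)"
      using A that assms by (intro A(2)) (auto intro: supports_Int)
    then have "A \<inter> B = A"
      using A by (intro card_seteq) auto
    then show ?thesis by blast
  qed
  with A(1) have "supp act x = A"
    unfolding supp_def by blast
  with A(1) show "finite (supp act x)" "supports act (supp act x) x" by auto
qed

lemma act_eq_if_eq_on_supp: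
  assumes "x \<in> X" "\<pi> \<in> sorted_perms" "\<rho> \<in> sorted_perms"
    and "\<And>a. a \<in> supp act x \<Longrightarrow> \<pi> \<langle>$\<rangle> a = \<rho> \<langle>$\<rangle> a"
  shows "act \<pi> x = act \<rho> x"
  by (rule act_eq_if_eq_on_support[OF assms(1) supports_supp]) (use assms in auto)

lemma act_eq_self_if_fixes_supp:
  assumes "x \<in> X" "\<pi> \<in> sorted_perms" "\<And>a. a \<in> supp act x \<Longrightarrow> \<pi> \<langle>$\<rangle> a = a"
  shows "act \<pi> x = x"
  using supportsD[OF supports_supp] assms by blast

lemma act_inverse_cancel:
  assumes "x \<in> X" "\<pi> \<in> sorted_perms"
  shows "act (inverse \<pi>) (act \<pi> x) = x"
  using assms by (simp add: act_one sorted_perms_inverse flip: act_times)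

text \<open>If \<open>\<rho>\<close> fixes the image of \<open>A\<close> pointwise, then
  \<open>\<rho> * \<pi>\<close> and \<open>\<pi>\<close> agree on \<open>A\<close>.\<close>

lemma supports_act:
  assumes "x \<in> X" "\<pi> \<in> sorted_perms" "supports act A x"
  shows "supports act (apply \<pi> ` A) (act \<pi> x)"
  unfolding supports_def
proof (intro ballI impI)
  fix \<rho> assume \<rho>: "\<rho> \<in> sorted_perms" "\<forall>a\<in>apply \<pi> ` A. \<rho> \<langle>$\<rangle> a = a"
  have "act (\<rho> * \<pi>) x = act \<pi> x"
    by (rule act_eq_if_eq_on_support[OF assms(1,3)])
      (use assms \<rho> in \<open>auto simp: sorted_perms_times apply_times\<close>)
  with \<rho> assms show "act \<rho> (act \<pi> x) = act \<pi> x" by (simp add: act_times)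
qed

text \<open>One inclusion follows from \<open>supports_act\<close>; the other is the same inclusion
  for \<open>inverse \<pi>\<close> at \<open>act \<pi> x\<close>.\<close>

lemma supp_act:
  assumes "x \<in> X" "\<pi> \<in> sorted_perms"
  shows "supp act (act \<pi> x) = apply \<pi> ` supp act x"
proof -
  have sub: "supp act (act \<sigma> y) \<subseteq> apply \<sigma> ` supp act y"
    if "y \<in> X" "\<sigma> \<in> sorted_perms" for y \<sigma>
    using that by (intro supp_subset supports_act) (auto simp: finite_supp supports_supp)
  have "supp act x \<subseteq> apply (inverse \<pi>) ` supp act (act \<pi> x)"
    using sub[of "act \<pi> x" "inverse \<pi>"] assms
    by (simp add: act_closed sorted_perms_inverse act_inverse_cancel)
  then have "apply \<pi> ` supp act x \<subseteq> supp act (act \<pi> x)"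
    by (auto simp: apply_inverse_cancel)
  with sub[OF assms] show ?thesis by blast
qed

section \<open>Alpha-equivalence\<close>

text \<open>Inverses and products of renamings witness symmetry and transitivity. By
  \<open>supp_act\<close>, a renaming carries the free names \<open>supp act x - N\<close> onto
  those of the image, so the condition of fixing them carries over.\<close>

lemma equiv_alpha_rel: "equiv ({N. finite N} \<times> X) (alpha_rel X act)"
proof (rule equivI)
  show "alpha_rel X act \<subseteq> ({N. finite N} \<times> X) \<times> ({N. finite N} \<times> X)"
    by (auto simp: alpha_rel_def)
  show "refl_on ({N. finite N} \<times> X) (alpha_rel X act)"
    unfolding refl_on_def alpha_rel_def
    by (auto simp: perm_prod_def perm_set_def act_one sorted_perms_one intro!: bexI[of _ 1])
  show "sym (alpha_rel X act)"
  proof (rule symI, clarify)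
    fix N x N' x' assume "((N, x), (N', x')) \<in> alpha_rel X act"
    then obtain \<pi> where \<pi>: "finite N" "x \<in> X" "\<pi> \<in> sorted_perms" "N' = apply \<pi> ` N" "x' = act \<pi> x"
      "\<forall>a\<in>supp act x - N. \<pi> \<langle>$\<rangle> a = a"
      by (auto simp: alpha_rel_def perm_prod_def perm_set_def)
    have "inverse \<pi> \<langle>$\<rangle> a = a" if a: "a \<in> supp act x' - N'" for a
    proof -
      obtain b where "b \<in> supp act x - N" "a = \<pi> \<langle>$\<rangle> b"
        using a unfolding \<pi>(4,5) supp_act[OF \<pi>(2,3)] by blast
      with \<pi>(6) show ?thesis by (metis apply_inverse_cancel(1))
    qed
    with \<pi> show "((N', x'), (N, x)) \<in> alpha_rel X act"
      by (auto simp: alpha_rel_def perm_prod_def perm_set_def act_closed act_inverse_cancel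
          sorted_perms_inverse image_image apply_inverse_cancel intro!: bexI[of _ "inverse \<pi>"])
  qed
  show "trans (alpha_rel X act)"
  proof (rule transI, clarify)
    fix N x N' x' N'' x''
    assume "((N, x), (N', x')) \<in> alpha_rel X act" "((N', x'), (N'', x'')) \<in> alpha_rel X act"
    then obtain \<pi> \<sigma> where \<pi>: "finite N" "x \<in> X" "\<pi> \<in> sorted_perms" "N' = apply \<pi> ` N"
        "x' = act \<pi> x" "\<forall>a\<in>supp act x - N. \<pi> \<langle>$\<rangle> a = a"
      and \<sigma>: "\<sigma> \<in> sorted_perms" "N'' = apply \<sigma> ` N'" "x'' = act \<sigma> x'"
        "\<forall>a\<in>supp act x' - N'. \<sigma> \<langle>$\<rangle> a = a"
      by (auto simp: alpha_rel_def perm_prod_def perm_set_def)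
    have "(\<sigma> * \<pi>) \<langle>$\<rangle> a = a" if a: "a \<in> supp act x - N" for a
    proof -
      have "\<pi> \<langle>$\<rangle> a \<in> supp act x' - N'"
        using a \<pi>(2-5) by (auto simp: supp_act apply_inj)
      with \<sigma>(4) \<pi>(6) a show ?thesis by (simp add: apply_times)
    qed
    with \<pi> \<sigma> show "((N, x), (N'', x'')) \<in> alpha_rel X act"
      by (auto simp: alpha_rel_def perm_prod_def perm_set_def act_closed act_times image_image
          apply_times sorted_perms_times intro!: bexI[of _ "\<sigma> * \<pi>"])
  qed
qed

lemma abstr_eq_iff:
  assumes "finite N" "x \<in> X" "finite N'" "x' \<in> X"
  shows "abstr X act N x = abstr X act N' x' \<longleftrightarrow> ((N, x), (N', x')) \<in> alpha_rel X act"
  unfolding abstr_def using assms by (intro eq_equiv_class_iff[OF equiv_alpha_rel]) auto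

text \<open>Names that neither side binds can be fixed as well, even outside
  \<open>supp act x\<close>. Only the values of the old witness \<open>\<pi>\<close> on
  \<open>supp act x \<union> N\<close> matter; there it is compatible with the identity on
  \<open>B\<close>, and the combined partial map extends to a permutation.\<close>

lemma alpha_rel_fixing:
  assumes "((N, x), (N', x')) \<in> alpha_rel X act"
    and "N \<inter> B = {}" "N' \<inter> B = {}"
  obtains \<pi> where "\<pi> \<in> sorted_perms" "apply \<pi> ` N = N'" "act \<pi> x = x'"
    "\<And>a. a \<in> supp act x - N \<Longrightarrow> \<pi> \<langle>$\<rangle> a = a" "\<And>a. a \<in> B \<Longrightarrow> \<pi> \<langle>$\<rangle> a = a"
proof -
  obtain \<pi> where \<pi>: "finite N" "x \<in> X" "\<pi> \<in> sorted_perms" "N' = apply \<pi> ` N" "x' = act \<pi> x"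
    "\<forall>a\<in>supp act x - N. \<pi> \<langle>$\<rangle> a = a"
    using assms(1) by (auto simp: alpha_rel_def perm_prod_def perm_set_def)
  let ?D = "supp act x \<union> N" and ?g = "\<lambda>a. if a \<in> B then a else \<pi> \<langle>$\<rangle> a"
  \<comment> \<open>A name of \<open>B\<close> in \<open>?D\<close> is free in \<open>x\<close>,
    because \<open>N\<close> avoids \<open>B\<close>; so \<open>\<pi>\<close> fixes it
    already.\<close>
  have g: "?g a = \<pi> \<langle>$\<rangle> a" if "a \<in> ?D" for a
    using that \<pi>(6) assms(2) by (metis DiffI Un_iff disjoint_iff)
  \<comment> \<open>Names of \<open>N\<close> go to \<open>N'\<close>, which avoids
    \<open>B\<close>, and the other names of \<open>?D\<close> stay put. This makes
    \<open>?g\<close> injective.\<close>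
  have avoid: "\<pi> \<langle>$\<rangle> a \<notin> B" if "a \<in> ?D" "a \<notin> B" for a
    using that \<pi>(4,6) assms(3) by (cases "a \<in> N") auto
  obtain \<rho> where \<rho>: "\<rho> \<in> sorted_perms" "\<And>a. a \<in> B \<union> ?D \<Longrightarrow> \<rho> \<langle>$\<rangle> a = ?g a"
  proof (rule extend_to_sorted_perm[of ?D ?g B "\<lambda>_. True"])
    show "finite ?D" using \<pi> by (simp add: finite_supp)
    show "inj_on ?g (B \<union> ?D)"
      using avoid by (auto simp: inj_on_def apply_inj split: if_splits)
    show "sort_of (?g a) = sort_of a" for a
      using \<pi>(3) by (simp add: sorted_perms_def)
  qed auto
  have eq: "\<rho> \<langle>$\<rangle> a = \<pi> \<langle>$\<rangle> a" if "a \<in> ?D" for a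
    using \<rho>(2) g that by auto
  show thesis
  proof
    show "apply \<rho> ` N = N'" using eq \<pi>(4) by simp
    show "act \<rho> x = x'"
      using act_eq_if_eq_on_supp[OF \<pi>(2) \<rho>(1) \<pi>(3)] eq \<pi>(5) by simp
    show "\<rho> \<langle>$\<rangle> a = a" if "a \<in> supp act x - N" for a
      using that eq \<pi>(6) by simp
    show "\<rho> \<langle>$\<rangle> a = a" if "a \<in> B" for a
      using that \<rho>(2) by simp
  qed (rule \<rho>(1))
qed

text \<open>When nothing is bound, the witness has to fix all of \<open>supp act x\<close>.\<close>

lemma alpha_rel_empty:
  assumes "(({}, x), ({}, x')) \<in> alpha_rel X act"
  shows "x' = x"
  using assms act_eq_self_if_fixes_supp by (auto simp: alpha_rel_def perm_prod_def)

text \<open>This gives sets \<open>F\<close> of effects a least support. As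
  \<open>supports_act\<close> presupposes a nominal set, closure under the action is shown directly
  by conjugation.\<close>

lemma nominal_set_Pfs: "nominal_set (Pfs act X) (perm_set act)"
proof
  fix \<pi> :: "'n perm" and A assume \<pi>: "\<pi> \<in> sorted_perms" and A: "A \<in> Pfs act X"
  then obtain B where B: "finite B" "supports (perm_set act) B A" and AX: "A \<subseteq> X"
    by (auto simp: Pfs_def finitely_supported_def)
  have "supports (perm_set act) (apply \<pi> ` B) (perm_set act \<pi> A)"
    unfolding supports_def
  proof (intro ballI impI)
    fix \<rho> assume \<rho>: "\<rho> \<in> sorted_perms" "\<forall>a\<in>apply \<pi> ` B. \<rho> \<langle>$\<rangle> a = a"
    \<comment> \<open>The conjugate of \<open>\<rho>\<close> fixes \<open>B\<close> pointwise, hence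
      fixes \<open>A\<close>; moving \<open>\<pi>\<close> to the other side gives the claim.\<close>
    let ?\<sigma> = "inverse \<pi> * (\<rho> * \<pi>)"
    have \<sigma>: "?\<sigma> \<in> sorted_perms"
      using \<pi> \<rho> by (simp add: sorted_perms_times sorted_perms_inverse)
    have "perm_set act ?\<sigma> A = A"
      by (rule supportsD[OF B(2) \<sigma>]) (use \<rho> in \<open>simp add: apply_times apply_inverse_cancel\<close>)
    then have "perm_set act \<pi> A = act \<pi> ` act ?\<sigma> ` A"
      by (simp add: perm_set_def)
    also have "\<dots> = (\<lambda>x. act (\<pi> * ?\<sigma>) x) ` A"
      unfolding image_image using AX \<pi> \<sigma> by (intro image_cong refl act_times[symmetric]) auto
    also have "\<pi> * ?\<sigma> = \<rho> * \<pi>" by (simp flip: mult.assoc)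
    also have "act (\<rho> * \<pi>) ` A = perm_set act \<rho> (perm_set act \<pi> A)"
      unfolding perm_set_def image_image using AX \<pi> \<rho> by (intro image_cong refl act_times) auto
    finally show "perm_set act \<rho> (perm_set act \<pi> A) = perm_set act \<pi> A" by (rule sym)
  qed
  with B AX \<pi> show "perm_set act \<pi> A \<in> Pfs act X"
    by (auto simp: Pfs_def finitely_supported_def perm_set_def act_closed)
next
  fix A assume "A \<in> Pfs act X"
  then have "act 1 ` A = id ` A"
    by (intro image_cong) (auto simp: Pfs_def act_one)
  then show "perm_set act 1 A = A"
    by (simp add: perm_set_def)
next
  fix \<pi> \<sigma> :: "'n perm" and A
  assume "\<pi> \<in> sorted_perms" "\<sigma> \<in> sorted_perms" "A \<in> Pfs act X"
  then show "perm_set act (\<pi> * \<sigma>) A = perm_set act \<pi> (perm_set act \<sigma> A)"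
    unfolding perm_set_def image_image by (intro image_cong refl act_times) (auto simp: Pfs_def)
qed (simp add: Pfs_def)

end

section \<open>The \<open>L\<close>-transform\<close>

lemma bisimulationI:
  assumes "R \<subseteq> States T \<times> States T" "sym R"
    and "\<And>P Q \<phi>. \<lbrakk>(P, Q) \<in> R; \<phi> \<in> Preds T; (P, \<phi>) \<in> sat T\<rbrakk> \<Longrightarrow> (Q, \<phi>) \<in> sat T"
    and "\<And>P Q \<alpha> P'. \<lbrakk>(P, Q) \<in> R; \<alpha> \<in> Acts T; P' \<in> States T; fresh (perm_state T) (bn T \<alpha>) Q;
      step T P \<alpha> P'\<rbrakk> \<Longrightarrow> \<exists>Q'\<in>States T. step T Q \<alpha> Q' \<and> (P', Q') \<in> R"
  shows "bisimulation T R"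
  using assms unfolding bisimulation_def by blast

text \<open>The union of the two supports works. The third action is arbitrary, so that products and
  the constructors \<open>EF\<close> and \<open>AC\<close> are all covered.\<close>

lemma finitely_supported_pairI:
  assumes "finitely_supported act x" "finitely_supported act' y"
    and "\<And>\<pi>. act \<pi> x = x \<Longrightarrow> act' \<pi> y = y \<Longrightarrow> act'' \<pi> z = z"
  shows "finitely_supported act'' z"
proof -
  obtain A B where "finite A" "supports act A x" "finite B" "supports act' B y"
    using assms by (auto simp: finitely_supported_def)
  then have "finite (A \<union> B)" "supports act'' (A \<union> B) z"
    using assms(3) by (auto simp: supports_def)
  then show ?thesis by (auto simp: finitely_supported_def)
qed

lemma nominal_set_prod:
  assumes "nominal_set X actx" "nominal_set Y acty"
  shows "nominal_set (X \<times> Y) (perm_prod actx acty)"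
proof -
  interpret X: nominal_set X actx by fact
  interpret Y: nominal_set Y acty by fact
  show ?thesis
    by unfold_locales
      (auto simp: perm_prod_def X.act_closed X.act_one X.act_times Y.act_closed Y.act_one
        Y.act_times intro: finitely_supported_pairI[OF X.finite_support Y.finite_support])
qed

section \<open>States and actions of the transform as nominal sets\<close>

context
  fixes T :: "('n::names, 's, 'p, 'a) nts" and \<F> :: "('s \<Rightarrow> 's) set"
  assumes T: "nominal_transition_system T" and \<F>: "nominal_effect_set T \<F>"
begin

interpretation S: nominal_set "States T" "perm_state T"
  using T by (simp add: nominal_transition_system_def)

interpretation A: nominal_set "Acts T" "perm_act T"
  using T by (simp add: nominal_transition_system_def)

interpretation E: nominal_set \<F> "perm_eff T"
  using \<F> by (simp add: nominal_effect_set_def)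

interpretation P: nominal_set "Pfs (perm_eff T) \<F>" "perm_set (perm_eff T)"
  by (rule E.nominal_set_Pfs)

lemma effect_state: "f \<in> \<F> \<Longrightarrow> P \<in> States T \<Longrightarrow> f P \<in> States T"
  using \<F> by (auto simp: nominal_effect_set_def effects_def)

lemma nominal_set_lstates: "nominal_set (lstates T \<F>) (perm_lstate T)"
proof
  fix x assume "x \<in> lstates T \<F>"
  then consider (AC) f F P where "x = AC f F P" "f \<in> \<F>" "F \<in> Pfs (perm_eff T) \<F>" "P \<in> States T"
    | (EF) F P where "x = EF F P" "F \<in> Pfs (perm_eff T) \<F>" "P \<in> States T"
    by (auto simp: lstates_def)
  then show "finitely_supported (perm_lstate T) x"
  proof cases
    case AC
    \<comment> \<open>The three components of \<open>AC\<close> are treated as \<open>f\<close>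
      together with the pair \<open>(F, P)\<close>.\<close>
    then have "finitely_supported (perm_prod (perm_set (perm_eff T)) (perm_state T)) (F, P)"
      by (intro finitely_supported_pairI[OF P.finite_support S.finite_support])
        (auto simp: perm_prod_def)
    with AC show ?thesis
      by (auto simp: perm_prod_def intro: finitely_supported_pairI[OF E.finite_support])
  next
    case EF
    then show ?thesis
      by (auto intro: finitely_supported_pairI[OF P.finite_support S.finite_support])
  qed
qed (auto simp: lstates_def E.act_closed E.act_one E.act_times P.act_closed P.act_one P.act_times
    S.act_closed S.act_one S.act_times)

lemma nominal_set_lacts: "nominal_set (Acts T <+> \<F>) (perm_lact T)"
proof
  fix x assume "x \<in> Acts T <+> \<F>"
  then show "finitely_supported (perm_lact T) x"
    using A.finite_support E.finite_support
    by (fastforce simp: perm_lact_def finitely_supported_def supports_def)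
qed (auto simp: perm_lact_def A.act_closed A.act_one A.act_times E.act_closed E.act_one E.act_times)

interpretation R: nominal_set "Acts T \<times> States T" "perm_prod (perm_act T) (perm_state T)"
  by (intro nominal_set_prod S.nominal_set_axioms A.nominal_set_axioms)

interpretation LR: nominal_set "(Acts T <+> \<F>) \<times> lstates T \<F>"
    "perm_prod (perm_lact T) (perm_lstate T)"
  by (intro nominal_set_prod nominal_set_lstates nominal_set_lacts)

section \<open>Transitions of the transform\<close>

lemma residual_L_transform:
  "residual (L_transform T \<F> L) (bn (L_transform T \<F> L) x) x S =
    lresidual T \<F> (case_sum (bn T) (\<lambda>_. {}) x) x S"
  by (simp add: residual_def lresidual_def L_transform_def)

text \<open>Steps are given by residuals, hence only up to alpha-equivalence; but effect labels bind
  no names, so here the residual determines the label and the target.\<close>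

lemma step_L_transform_EF_iff:
  assumes "x \<in> Acts T <+> \<F>" "S \<in> lstates T \<F>" "F \<in> Pfs (perm_eff T) \<F>" "P \<in> States T"
  shows "step (L_transform T \<F> L) (EF F P) x S \<longleftrightarrow> (\<exists>f\<in>F. x = Inr f \<and> S = AC f F (f P))"
proof
  assume "step (L_transform T \<F> L) (EF F P) x S"
  then obtain f where f: "f \<in> F" and
    eq: "lresidual T \<F> {} (Inr f) (AC f F (f P)) = lresidual T \<F> (case_sum (bn T) (\<lambda>_. {}) x) x S"
    unfolding step_def residual_L_transform by (auto simp: L_transform_def)
  have "f \<in> \<F>" using f assms(3) by (auto simp: Pfs_def)
  moreover have "finite (case_sum (bn T) (\<lambda>_. {}) x)"
    using assms(1) T by (auto simp: nominal_transition_system_def)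
  ultimately have \<alpha>: "(({}, (Inr f, AC f F (f P))), (case_sum (bn T) (\<lambda>_. {}) x, (x, S)))
      \<in> alpha_rel ((Acts T <+> \<F>) \<times> lstates T \<F>) (perm_prod (perm_lact T) (perm_lstate T))"
    using eq assms unfolding lresidual_def
    by (subst (asm) LR.abstr_eq_iff) (auto simp: lstates_def effect_state)
  \<comment> \<open>Binding sets of alpha-equivalent pairs are images of each other, and the image
    of the empty set is empty.\<close>
  then have "case_sum (bn T) (\<lambda>_. {}) x = {}"
    by (auto simp: alpha_rel_def perm_prod_def perm_set_def)
  with \<alpha> have "(x, S) = (Inr f, AC f F (f P))"
    by (intro LR.alpha_rel_empty) simp
  with f show "\<exists>f\<in>F. x = Inr f \<and> S = AC f F (f P)" by blast
next
  assume "\<exists>f\<in>F. x = Inr f \<and> S = AC f F (f P)"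
  with assms show "step (L_transform T \<F> L) (EF F P) x S"
    unfolding step_def residual_L_transform by (auto simp: L_transform_def)
qed

lemma step_L_transform_ACI:
  assumes "\<alpha> \<in> Acts T" "f \<in> \<F>" "F \<in> Pfs (perm_eff T) \<F>" "P \<in> States T" "P' \<in> States T"
    and "step T P \<alpha> P'"
    and "fresh (perm_eff T) (bn T \<alpha>) f" "fresh (perm_set (perm_eff T)) (bn T \<alpha>) F"
  shows "step (L_transform T \<F> L) (AC f F P) (Inl \<alpha>) (EF (L (\<alpha>, F, f)) P')"
  using assms unfolding step_def[of "L_transform T \<F> L"] residual_L_transform
  by (auto simp: L_transform_def)

text \<open>The side condition in \<open>transitions\<close> concerns the representative
  \<open>\<beta>\<close>; the premises \<open>fresh_x\<close> say the same of the given label. Both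
  are needed to rename \<open>\<beta>\<close> to that label while fixing \<open>f\<close> and
  \<open>F\<close>.\<close>

lemma step_L_transform_ACE:
  assumes L_closed: "L \<in> Acts T \<times> Pfs (perm_eff T) \<F> \<times> \<F> \<rightarrow> Pfs (perm_eff T) \<F>"
    and L_eqvt: "equivariant_fun (Acts T \<times> Pfs (perm_eff T) \<F> \<times> \<F>)
      (perm_prod (perm_act T) (perm_prod (perm_set (perm_eff T)) (perm_eff T)))
      (perm_set (perm_eff T)) L"
    and x: "x \<in> Acts T <+> \<F>" and S: "S \<in> lstates T \<F>"
    and f: "f \<in> \<F>" and F: "F \<in> Pfs (perm_eff T) \<F>"
    and step: "step (L_transform T \<F> L) (AC f F P) x S"
    and fresh_x: "fresh (perm_eff T) (case_sum (bn T) (\<lambda>_. {}) x) f"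
      "fresh (perm_set (perm_eff T)) (case_sum (bn T) (\<lambda>_. {}) x) F"
  obtains \<alpha> P' where "x = Inl \<alpha>" "\<alpha> \<in> Acts T" "P' \<in> States T" "S = EF (L (\<alpha>, F, f)) P'"
    "step T P \<alpha> P'"
proof -
  let ?bnx = "case_sum (bn T) (\<lambda>_. {}) x"
  obtain \<beta> P' where \<beta>: "\<beta> \<in> Acts T" "P' \<in> States T" "step T P \<beta> P'"
      "fresh (perm_eff T) (bn T \<beta>) f" "fresh (perm_set (perm_eff T)) (bn T \<beta>) F"
    and eq: "lresidual T \<F> (bn T \<beta>) (Inl \<beta>) (EF (L (\<beta>, F, f)) P') = lresidual T \<F> ?bnx x S"
    using step unfolding step_def[of "L_transform T \<F> L"] residual_L_transform
    by (auto simp: L_transform_def)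
  have L\<beta>: "L (\<beta>, F, f) \<in> Pfs (perm_eff T) \<F>"
    using L_closed \<beta>(1) F f by auto
  have fin: "finite ?bnx" "finite (bn T \<beta>)"
    using x \<beta>(1) T by (auto simp: nominal_transition_system_def)
  have "((bn T \<beta>, (Inl \<beta>, EF (L (\<beta>, F, f)) P')), (?bnx, (x, S)))
      \<in> alpha_rel ((Acts T <+> \<F>) \<times> lstates T \<F>) (perm_prod (perm_lact T) (perm_lstate T))"
    using eq fin x S \<beta>(1,2) L\<beta> unfolding lresidual_def
    by (subst (asm) LR.abstr_eq_iff) (auto simp: lstates_def)
  \<comment> \<open>Here \<open>B\<close> consists of the names of \<open>f\<close> and
    \<open>F\<close>, which both binding sets avoid.\<close>
  then obtain \<pi> where \<pi>: "\<pi> \<in> sorted_perms" "apply \<pi> ` bn T \<beta> = ?bnx"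
    and act: "perm_prod (perm_lact T) (perm_lstate T) \<pi> (Inl \<beta>, EF (L (\<beta>, F, f)) P') = (x, S)"
    and fixes_supp: "\<And>a. a \<in> supp (perm_prod (perm_lact T) (perm_lstate T))
        (Inl \<beta>, EF (L (\<beta>, F, f)) P') - bn T \<beta> \<Longrightarrow> \<pi> \<langle>$\<rangle> a = a"
    and fixes_fF: "\<And>a. a \<in> supp (perm_eff T) f \<union> supp (perm_set (perm_eff T)) F
        \<Longrightarrow> \<pi> \<langle>$\<rangle> a = a"
    by (rule LR.alpha_rel_fixing
        [of _ _ _ _ "supp (perm_eff T) f \<union> supp (perm_set (perm_eff T)) F"])
      (use \<beta>(4,5) fresh_x in \<open>auto simp: fresh_def\<close>)
  have \<pi>f: "perm_eff T \<pi> f = f" and \<pi>F: "perm_set (perm_eff T) \<pi> F = F"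
    using E.act_eq_self_if_fixes_supp[OF f \<pi>(1)] P.act_eq_self_if_fixes_supp[OF F \<pi>(1)] fixes_fF
    by blast+
  define \<alpha> where "\<alpha> = perm_act T \<pi> \<beta>"
  have x_eq: "x = Inl \<alpha>"
    and S_eq: "S = EF (perm_set (perm_eff T) \<pi> (L (\<beta>, F, f))) (perm_state T \<pi> P')"
    using act by (auto simp: perm_prod_def perm_lact_def \<alpha>_def)
  have \<alpha>: "\<alpha> \<in> Acts T" "perm_state T \<pi> P' \<in> States T"
    using \<beta> \<pi>(1) by (auto simp: \<alpha>_def A.act_closed S.act_closed)
  have L\<alpha>: "perm_set (perm_eff T) \<pi> (L (\<beta>, F, f)) = L (\<alpha>, F, f)"
  proof -
    have "L (perm_prod (perm_act T) (perm_prod (perm_set (perm_eff T)) (perm_eff T)) \<pi> (\<beta>, F, f))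
        = perm_set (perm_eff T) \<pi> (L (\<beta>, F, f))"
      using L_eqvt \<pi>(1) \<beta>(1) F f unfolding equivariant_fun_def by blast
    then show ?thesis by (simp add: perm_prod_def \<alpha>_def \<pi>f \<pi>F)
  qed
  \<comment> \<open>This leads back to \<open>T\<close>: whatever supports the larger pair supports
    \<open>(\<beta>, P')\<close>, so \<open>\<pi>\<close> fixes the free names of
    \<open>(\<beta>, P')\<close> and witnesses alpha-equivalence in \<open>T\<close> too.\<close>
  have supp_le: "supp (perm_prod (perm_act T) (perm_state T)) (\<beta>, P')
      \<subseteq> supp (perm_prod (perm_lact T) (perm_lstate T)) (Inl \<beta>, EF (L (\<beta>, F, f)) P')"
    by (rule supp_mono) (auto simp: supports_def perm_prod_def perm_lact_def)
  have "((bn T \<beta>, (\<beta>, P')), (bn T \<alpha>, (\<alpha>, perm_state T \<pi> P')))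
      \<in> alpha_rel (Acts T \<times> States T) (perm_prod (perm_act T) (perm_state T))"
    using \<pi> \<beta>(1,2) \<alpha> fin fixes_supp supp_le x_eq
    by (auto simp: alpha_rel_def perm_prod_def perm_set_def \<alpha>_def intro!: bexI[of _ \<pi>])
  then have "residual T (bn T \<beta>) \<beta> P' = residual T (bn T \<alpha>) \<alpha> (perm_state T \<pi> P')"
    using fin x_eq \<beta>(1,2) \<alpha> unfolding residual_def by (subst R.abstr_eq_iff) auto
  with \<beta>(3) have "step T P \<alpha> (perm_state T \<pi> P')"
    by (simp add: step_def)
  with that[OF x_eq \<alpha>] S_eq L\<alpha> show thesis by simp
qed

section \<open>The bisimulation\<close>

lemma fresh_AC:
  assumes "fresh (perm_lstate T) N (AC f F P)"
  shows "fresh (perm_eff T) N f" "fresh (perm_set (perm_eff T)) N F" "fresh (perm_state T) N P"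
proof -
  \<comment> \<open>Permutations act componentwise, so a set supporting the state supports each
    component.\<close>
  have "supp (perm_eff T) f \<subseteq> supp (perm_lstate T) (AC f F P)"
    "supp (perm_set (perm_eff T)) F \<subseteq> supp (perm_lstate T) (AC f F P)"
    "supp (perm_state T) P \<subseteq> supp (perm_lstate T) (AC f F P)"
    by (rule supp_mono; simp add: supports_def)+
  with assms show "fresh (perm_eff T) N f" "fresh (perm_set (perm_eff T)) N F"
    "fresh (perm_state T) N P"
    by (auto simp: fresh_def)
qed

text \<open>Freshness for \<open>AC f F (f Q)\<close> yields exactly the three freshness premises in
  the transition clause of \<open>L_bisimulation\<close>. A step from an \<open>EF\<close> pair
  merely selects \<open>f\<close>, and both sides can select the same one.\<close>

lemma bisimulation_L_transform:
  assumes L_closed: "L \<in> Acts T \<times> Pfs (perm_eff T) \<F> \<times> \<F> \<rightarrow> Pfs (perm_eff T) \<F>"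
    and L_eqvt: "equivariant_fun (Acts T \<times> Pfs (perm_eff T) \<F> \<times> \<F>)
      (perm_prod (perm_act T) (perm_prod (perm_set (perm_eff T)) (perm_eff T)))
      (perm_set (perm_eff T)) L"
    and R: "L_bisimulation T \<F> L R"
  shows "bisimulation (L_transform T \<F> L)
    ({(EF F P, EF F Q) | F P Q. F \<in> Pfs (perm_eff T) \<F> \<and> (P, Q) \<in> R F} \<union>
     {(AC f F (f P), AC f F (f Q)) | f F P Q. F \<in> Pfs (perm_eff T) \<F> \<and> f \<in> F \<and> (P, Q) \<in> R F})"
    (is "bisimulation ?LT ?R")
proof -
  have R_states: "P \<in> States T" "Q \<in> States T" and R_sym: "(Q, P) \<in> R F"
    if "F \<in> Pfs (perm_eff T) \<F>" "(P, Q) \<in> R F" for F P Q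
    using R that by (auto simp: L_bisimulation_def dest: symD)
  have R_sat: "(f Q, \<phi>) \<in> sat T"
    if "F \<in> Pfs (perm_eff T) \<F>" "(P, Q) \<in> R F" "f \<in> F" "\<phi> \<in> Preds T" "(f P, \<phi>) \<in> sat T"
    for F P Q f \<phi>
    using R that unfolding L_bisimulation_def by blast
  have R_step: "\<exists>Q'\<in>States T. step T (f Q) \<alpha> Q' \<and> (P', Q') \<in> R (L (\<alpha>, F, f))"
    if "F \<in> Pfs (perm_eff T) \<F>" "(P, Q) \<in> R F" "f \<in> F" "\<alpha> \<in> Acts T" "P' \<in> States T"
      "fresh (perm_state T) (bn T \<alpha>) (f Q)" "fresh (perm_set (perm_eff T)) (bn T \<alpha>) F"
      "fresh (perm_eff T) (bn T \<alpha>) f" "step T (f P) \<alpha> P'" for F P Q f \<alpha> P'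
    using R[unfolded L_bisimulation_def, THEN bspec, OF that(1), THEN conjunct2, THEN conjunct2,
        THEN bspec, OF that(2), unfolded prod.case, THEN conjunct2, THEN bspec, OF that(3),
        THEN bspec, OF that(4), THEN bspec, OF that(5)] that(6-)
    by blast
  have LT: "States ?LT = lstates T \<F>" "Preds ?LT = Preds T" "Acts ?LT = Acts T <+> \<F>"
    "perm_state ?LT = perm_lstate T" "bn ?LT = case_sum (bn T) (\<lambda>_. {})"
    by (simp_all add: L_transform_def)
  have mem: "f \<in> \<F>" if "F \<in> Pfs (perm_eff T) \<F>" "f \<in> F" for f F
    using that by (auto simp: Pfs_def)
  have EF_mem: "EF F P \<in> lstates T \<F>"
    if "F \<in> Pfs (perm_eff T) \<F>" "P \<in> States T" for F P
    using that by (auto simp: lstates_def)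
  have AC_mem: "AC f F (f P) \<in> lstates T \<F>"
    if "F \<in> Pfs (perm_eff T) \<F>" "f \<in> F" "P \<in> States T" for f F P
    using that mem[of F f] by (auto simp: lstates_def effect_state)
  have sub: "?R \<subseteq> lstates T \<F> \<times> lstates T \<F>"
    using R_states AC_mem EF_mem by blast
  have sym: "sym ?R"
    using R_sym unfolding sym_def by blast
  have sat: "(U', \<phi>) \<in> sat ?LT"
    if UV: "(U, U') \<in> ?R" and "\<phi> \<in> Preds T" "(U, \<phi>) \<in> sat ?LT" for U U' \<phi>
  proof -
    \<comment> \<open>Satisfaction in the transform includes membership in \<open>lstates\<close>.
      \<open>EF\<close> states satisfy nothing, so only \<open>AC\<close> pairs call on
      \<open>R_sat\<close>.\<close>
    have "U' \<in> lstates T \<F>" using UV sub by blast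
    with that show ?thesis by (auto simp: L_transform_def intro: R_sat)
  qed
  have step: "\<exists>V'\<in>lstates T \<F>. step ?LT U' x V' \<and> (V, V') \<in> ?R"
    if UV: "(U, U') \<in> ?R" and x: "x \<in> Acts T <+> \<F>" and V: "V \<in> lstates T \<F>"
      and fresh: "fresh (perm_lstate T) (case_sum (bn T) (\<lambda>_. {}) x) U'"
      and step: "step ?LT U x V" for U U' x V
    using UV
  proof
    assume "(U, U') \<in> {(EF F P, EF F Q) | F P Q. F \<in> Pfs (perm_eff T) \<F> \<and> (P, Q) \<in> R F}"
    then obtain F P Q where F: "F \<in> Pfs (perm_eff T) \<F>" "(P, Q) \<in> R F"
      and U: "U = EF F P" "U' = EF F Q"
      by blast
    obtain f where f: "f \<in> F" "x = Inr f" "V = AC f F (f P)"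
      using step step_L_transform_EF_iff[OF x V F(1)] R_states[OF F] unfolding U by blast
    have V': "AC f F (f Q) \<in> lstates T \<F>"
      using f F R_states[OF F] by (intro AC_mem)
    show ?thesis
    proof (intro bexI conjI)
      show "step ?LT U' x (AC f F (f Q))"
        using step_L_transform_EF_iff[OF x V' F(1)] R_states[OF F] f unfolding U by blast
      show "(V, AC f F (f Q)) \<in> ?R" using f F by blast
    qed (rule V')
  next
    assume "(U, U') \<in> {(AC f F (f P), AC f F (f Q)) | f F P Q.
      F \<in> Pfs (perm_eff T) \<F> \<and> f \<in> F \<and> (P, Q) \<in> R F}"
    then obtain f F P Q where F: "F \<in> Pfs (perm_eff T) \<F>" "(P, Q) \<in> R F" and f: "f \<in> F"
      and U: "U = AC f F (f P)" "U' = AC f F (f Q)"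
      by blast
    note fr = fresh_AC[OF fresh[unfolded U]]
    \<comment> \<open>Freshness is given for \<open>U'\<close>, but \<open>U\<close> has the same
      \<open>f\<close> and \<open>F\<close>, so the step of \<open>U\<close> can be
      decomposed.\<close>
    obtain \<alpha> P' where \<alpha>: "x = Inl \<alpha>" "\<alpha> \<in> Acts T" "P' \<in> States T" "V = EF (L (\<alpha>, F, f)) P'"
      "step T (f P) \<alpha> P'"
      using step_L_transform_ACE[OF L_closed L_eqvt x V mem[OF F(1) f] F(1) _ fr(1,2)] step
      unfolding U by blast
    obtain Q' where Q': "Q' \<in> States T" "step T (f Q) \<alpha> Q'" "(P', Q') \<in> R (L (\<alpha>, F, f))"
      using R_step[OF F f \<alpha>(2,3) _ _ _ \<alpha>(5)] fr \<alpha>(1) by auto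
    \<comment> \<open>Both targets carry the index \<open>L (\<alpha>, F, f)\<close>, so they form
      an \<open>EF\<close> pair of the relation.\<close>
    have L\<alpha>: "L (\<alpha>, F, f) \<in> Pfs (perm_eff T) \<F>"
      using L_closed \<alpha>(2) F(1) mem[OF F(1) f] by auto
    show ?thesis
    proof (intro bexI conjI)
      show "step ?LT U' x (EF (L (\<alpha>, F, f)) Q')"
        unfolding U \<alpha>(1)
        by (rule step_L_transform_ACI)
          (use \<alpha> F f mem Q' fr effect_state R_states[OF F] in auto)
      show "(V, EF (L (\<alpha>, F, f)) Q') \<in> ?R" using \<alpha>(4) Q'(3) L\<alpha> by blast
      show "EF (L (\<alpha>, F, f)) Q' \<in> lstates T \<F>" using L\<alpha> Q'(1) by (rule EF_mem)
    qed
  qed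
  show ?thesis
    by (rule bisimulationI[where T = ?LT, unfolded LT]) (fact sub sym sat step)+
qed

end

theorem theorem6p14:
  fixes T :: "('n::names, 's, 'p, 'a) nts"
    and \<F> :: "('s \<Rightarrow> 's) set"
    and L :: "'a \<times> ('s \<Rightarrow> 's) set \<times> ('s \<Rightarrow> 's) \<Rightarrow> ('s \<Rightarrow> 's) set"
  assumes "nominal_transition_system T"
    and "nominal_effect_set T \<F>"
    and "L \<in> Acts T \<times> Pfs (perm_eff T) \<F> \<times> \<F> \<rightarrow> Pfs (perm_eff T) \<F>"
    and "equivariant_fun (Acts T \<times> Pfs (perm_eff T) \<F> \<times> \<F>)
      (perm_prod (perm_act T) (perm_prod (perm_set (perm_eff T)) (perm_eff T)))
      (perm_set (perm_eff T)) L"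
  shows "\<forall>F\<in>Pfs (perm_eff T) \<F>. \<forall>P\<in>States T. \<forall>Q\<in>States T.
    L_bisimilar T \<F> L F P Q \<longrightarrow> (EF F P, EF F Q) \<in> bisimilarity (L_transform T \<F> L)"
proof (intro ballI impI)
  fix F P Q
  assume F: "F \<in> Pfs (perm_eff T) \<F>" and "L_bisimilar T \<F> L F P Q"
  then obtain R where R: "L_bisimulation T \<F> L R" "(P, Q) \<in> R F"
    by (auto simp: L_bisimilar_def)
  with F show "(EF F P, EF F Q) \<in> bisimilarity (L_transform T \<F> L)"
    using bisimulation_L_transform[OF assms R(1)] unfolding bisimilarity_def by blast
qed

end
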